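(* Let $\mathbb K$ be a proper ordered field extension of $\mathbb R$, let $(F,\delta,\Delta)$ be a galactic space (over $\mathbb K$) and let $\gamma>0$ be a limited element of $\mathbb K$. Then there exist a galactic space $(F_\gamma,\delta_\gamma,\Delta_\gamma)$ and a $\gamma$-contraction $f_\gamma:(F,\delta,\Delta)\to(F_\gamma,\delta_\gamma,\Delta_\gamma)$.
   Context: A proper ordered field extension $\mathbb K$ of $\mathbb R$ is an ordered field with $\mathbb R\subsetneq\mathbb K$ whose ordered field structure restricts to the usual one on $\mathbb R$. An element $s\in\mathbb K$ is infinitely small ($s\simeq 0$) if $|s|<1/n$ for all integers $n\ge 1$, infinitely large if $|s|>n$ for all $n\in\mathbb N$ (written $s\simeq+\infty$ if $s>0$, $s\simeq-\infty$ if $s<0$), and limited if it is not infinitely large. $\mathrm{Hal}(0)$ is the additive subgroup of infinitely small elements, and $s\simeq t$ means $s-t\in \mathrm{Hal}(0)$. $\mathrm{Gal}(0)$ is the additive subgroup of limited elements; $\mathrm{Gal}(\mathbb K)=\mathbb K/\mathrm{Gal}(0)$, and $\mathrm{Gal}:\mathbb K\to\mathrm{Gal}(\mathbb K)$ is the canonical projection. $\mathrm{Gal}(\mathbb K)$ is a totally ordered additive group for: $\mathrm{Gal}(s)\le\mathrm{Gal}(t)$ iff $s\le t$ or $s-t\in\mathrm{Gal}(0)$. For each limited $s$ there is a unique real ${}^o s$ with $s\simeq{}^o s$; the principal value map $\mathrm{pv}:\mathbb K\to\mathbb R\cup\{\pm\infty\}$ sends limited $s$ to ${}^o s$ and $s\simeq\pm\infty$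 to $\pm\infty$. For an ordered additive group $G$, $G_+=\{x\in G: x\ge 0\}$; the symbol $+\infty$ satisfies $x<+\infty$ and $x+(+\infty)=(+\infty)+x=+\infty$. A map $d$ on $X\times X$ with values in $G_+$ or $G_+\cup\{+\infty\}$ satisfies the general metric rule if for all $x,y,z\in X$: $d(x,x)=0$; $d(x,y)=d(y,x)>0$ if $x\ne y$; $d(x,z)\le d(x,y)+d(y,z)$. A generalized distance on a set $F$ is a map $\delta:F\times F\to\mathbb R_+\cup\{+\infty\}$ satisfying the general metric rule. The metric components of $F$ for $\delta$ are the equivalence classes of the relation $\delta(x,y)<+\infty$; $\mathcal M_F$ is the set of metric components and $C_F(x)$ is the one containing $x$. A galactic distance on a set $\mathcal E$ is a map $\Delta:\mathcal E\times\mathcal E\to\mathrm{Gal}(\mathbb K)_+$ satisfying the general metric rule. A galactic space is a triple $(F,\delta,\Delta)$ with $F$ a set, $\delta$ a generalized distance on $F$ and $\Delta$ a galactic distance on $\mathcal M_F$. For limited $\gamma>0$ in $\mathbb K$ and $\tau=\mathrm{Gal}(t)\in\mathrm{Gal}(\mathbb K)$, put $\gamma.\tau=\{\gamma s: s\in\tau\}\subset\mathbb K$ and $\gamma\bullet\tau=\mathrm{Gal}(\gamma t)\in\mathrm{Gal}(\mathbb K)$. If $\tau>0$, $\mathrm{pv}$ is constant on $\gamma.\tau$ and its value is denoted $\mathrm{pv}(\gamma.\tau)$. A morphism $(F,\delta,\Delta)\to(F',\delta',\Delta')$ is a map $f:F\to F'$ for which there is a limited $\gamma>0$ in $\mathbb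 K$ with (1) $\delta'(f(x_1),f(x_2))\le\gamma\,\delta(x_1,x_2)$ for all $x_1,x_2\in F$ (with $a\le+\infty$ and $\gamma\cdot(+\infty)=+\infty$), so that for each $E\in\mathcal M_F$ the image $f(E)$ lies in a unique metric component of $F'$, denoted $f[E]=\widetilde f(E)$; and (2) $\Delta'(f[E_1],f[E_2])\le\gamma\bullet\Delta(E_1,E_2)$ for all $E_1,E_2\in\mathcal M_F$. For limited $\gamma>0$ in $\mathbb K$, a $\gamma$-contraction of $(F,\delta,\Delta)$ is a morphism $f:(F,\delta,\Delta)\to(F',\delta',\Delta')$ that is surjective as a map $F\to F'$ and such that for all $x_1,x_2\in F$ and $E_1,E_2\in\mathcal M_F$: $\delta'(f(x_1),f(x_2))=\mathrm{pv}(\gamma\,\delta(x_1,x_2))$ if $\delta(x_1,x_2)<+\infty$; $\delta'(f(x_1),f(x_2))=\mathrm{pv}(\gamma.\Delta(C_F(x_1),C_F(x_2)))$ if $\delta(x_1,x_2)=+\infty$; and $\Delta'(f[E_1],f[E_2])=\gamma\bullet\Delta(E_1,E_2)$. *)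

theory Defs
  imports Complex_Main "HOL-Library.Extended_Real"
begin

text \<open>
  An ordered field extension of the reals is a type of sort
  \<open>{linordered_field, real_field}\<close>, the embedding of the reals being \<open>of_real\<close>. Compatibility
  of the two orders is automatic:
\<close>

lemma of_real_le_iff_ordered_field:
  fixes r s :: real
  shows "(of_real r :: 'k::{linordered_field, real_field}) \<le> of_real s \<longleftrightarrow> r \<le> s"
proof -
  have nonneg: "(of_real t :: 'k) \<ge> 0" if "t \<ge> 0" for t
  proof -
    have "(of_real t :: 'k) = of_real (sqrt t) * of_real (sqrt t)"
      using that by (simp flip: of_real_mult)
    then show ?thesis by simp
  qed
  have mono: "(of_real a :: 'k) \<le> of_real b" if "a \<le> b" for a b
    using nonneg[of "b - a"] that by simp
  show ?thesis
    using mono[of r s] mono[of s r] by (metis antisym linear of_real_eq_iff)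
qed


section \<open>Infinitely small, infinitely large and limited elements\<close>

definition inf_small :: "'k::linordered_field \<Rightarrow> bool" where
  "inf_small s \<longleftrightarrow> (\<forall>n::nat. n \<ge> 1 \<longrightarrow> \<bar>s\<bar> < 1 / of_nat n)"

definition inf_close :: "'k::linordered_field \<Rightarrow> 'k \<Rightarrow> bool" (infix "\<simeq>" 50) where
  "s \<simeq> t \<longleftrightarrow> inf_small (s - t)"

definition inf_large :: "'k::linordered_field \<Rightarrow> bool" where
  "inf_large s \<longleftrightarrow> (\<forall>n::nat. \<bar>s\<bar> > of_nat n)"

definition limited :: "'k::linordered_field \<Rightarrow> bool" where
  "limited s \<longleftrightarrow> \<not> inf_large s"

lemma limited_iff: "limited s \<longleftrightarrow> (\<exists>n::nat. \<bar>s\<bar> \<le> of_nat n)"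
  by (auto simp: limited_def inf_large_def not_less)

lemma limited_0: "limited 0"
  by (auto simp: limited_iff)

lemma limited_uminus: "limited (- s) \<longleftrightarrow> limited s"
  by (simp add: limited_iff)

lemma limited_add:
  assumes "limited s" "limited t"
  shows "limited (s + t)"
proof -
  obtain m n :: nat where "\<bar>s\<bar> \<le> of_nat m" "\<bar>t\<bar> \<le> of_nat n"
    using assms by (auto simp: limited_iff)
  then have "\<bar>s + t\<bar> \<le> of_nat (m + n)"
    using abs_triangle_ineq[of s t] by simp
  then show ?thesis unfolding limited_iff by blast
qed

lemma limited_mult:
  assumes "limited s" "limited t"
  shows "limited (s * t)"
proof -
  obtain m n :: nat where "\<bar>s\<bar> \<le> of_nat m" "\<bar>t\<bar> \<le> of_nat n"
    using assms by (auto simp: limited_iff)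
  then have "\<bar>s * t\<bar> \<le> of_nat (m * n)"
    by (simp add: abs_mult mult_mono)
  then show ?thesis unfolding limited_iff by blast
qed

lemma limited_between:
  assumes "limited a" "limited b" "a \<le> s" "s \<le> b"
  shows "limited s"
proof -
  obtain m n :: nat where "\<bar>a\<bar> \<le> of_nat m" "\<bar>b\<bar> \<le> of_nat n"
    using assms by (auto simp: limited_iff)
  moreover have "\<bar>s\<bar> \<le> \<bar>a\<bar> + \<bar>b\<bar>" using assms(3,4) by linarith
  ultimately have "\<bar>s\<bar> \<le> of_nat (m + n)" by simp
  then show ?thesis unfolding limited_iff by blast
qed

definition std_part :: "'k::{linordered_field, real_field} \<Rightarrow> real" where
  "std_part s = (THE r. s \<simeq> of_real r)"

definition pv :: "'k::{linordered_field, real_field} \<Rightarrow> ereal" where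
  "pv s = (if limited s then ereal (std_part s) else if s > 0 then \<infinity> else - \<infinity>)"


section \<open>The ordered group of galaxies\<close>

definition galrel :: "'k::linordered_field \<Rightarrow> 'k \<Rightarrow> bool" where
  "galrel s t \<longleftrightarrow> limited (s - t)"

quotient_type (overloaded) 'k gal = "'k::linordered_field" / galrel
  morphisms rep_gal Gal
proof (rule equivpI)
  show "reflp (galrel :: 'k \<Rightarrow> _)"
    by (simp add: reflp_def galrel_def limited_0)
  show "symp (galrel :: 'k \<Rightarrow> _)"
    unfolding symp_def galrel_def by (metis limited_uminus minus_diff_eq)
  show "transp (galrel :: 'k \<Rightarrow> _)"
    unfolding transp_def galrel_def by (metis limited_add diff_add_cancel add_diff_eq)
qed

lemma Gal_eq_iff: "Gal s = Gal t \<longleftrightarrow> limited (s - t)"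
  by (simp add: gal.abs_eq_iff galrel_def)

instantiation gal :: (linordered_field) linordered_ab_group_add
begin

lift_definition zero_gal :: "'a gal" is 0 .

lift_definition plus_gal :: "'a gal \<Rightarrow> 'a gal \<Rightarrow> 'a gal" is "(+)"
  unfolding galrel_def by (metis limited_add add_diff_add)

lift_definition uminus_gal :: "'a gal \<Rightarrow> 'a gal" is uminus
  unfolding galrel_def by (metis limited_uminus minus_diff_minus)

lift_definition minus_gal :: "'a gal \<Rightarrow> 'a gal \<Rightarrow> 'a gal" is "(-)"
  unfolding galrel_def
  by (metis limited_add limited_uminus add_diff_add diff_conv_add_uminus minus_diff_minus)

lift_definition less_eq_gal :: "'a gal \<Rightarrow> 'a gal \<Rightarrow> bool" is
  "\<lambda>s t. s \<le> t \<or> limited (s - t)"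
proof -
  have *: "s' \<le> t' \<or> limited (s' - t')"
    if "galrel s s'" "galrel t t'" "s \<le> t \<or> limited (s - t)" for s s' t t' :: 'a
  proof (cases "limited (s - t)")
    case True
    have "s' - t' = - (s - s') + (s - t) + (t - t')" by simp
    with that(1,2) True show ?thesis
      unfolding galrel_def by (metis limited_add limited_uminus)
  next
    case False
    then have "s - t \<le> 0" using that(3) by simp
    then have "s' - t' \<le> - (s - s') + (t - t')" by (simp add: algebra_simps)
    moreover have "limited (- (s - s') + (t - t'))"
      using that(1,2) unfolding galrel_def by (metis limited_add limited_uminus)
    ultimately show ?thesis
      using limited_between[OF limited_0, of _ "s' - t'"] by fastforce
  qed
  have "galrel s' s" if "galrel s s'" for s s' :: 'a
    using that unfolding galrel_def by (metis limited_uminus minus_diff_eq)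
  with * show "\<And>s s' t t' :: 'a. galrel s s' \<Longrightarrow> galrel t t' \<Longrightarrow>
      (s \<le> t \<or> limited (s - t)) = (s' \<le> t' \<or> limited (s' - t'))"
    by blast
qed

definition less_gal :: "'a gal \<Rightarrow> 'a gal \<Rightarrow> bool" where
  "less_gal x y \<longleftrightarrow> x \<le> y \<and> \<not> y \<le> x"

instance
proof
  fix x y z :: "'a gal"
  show "(x < y) = (x \<le> y \<and> \<not> y \<le> x)" by (rule less_gal_def)
  show "x + y + z = x + (y + z)"
    by transfer (simp add: galrel_def limited_0 add.assoc)
  show "x + y = y + x"
    by transfer (simp add: galrel_def limited_0 add.commute)
  show "0 + x = x"
    by transfer (simp add: galrel_def limited_0)
  show "- x + x = 0"
    by transfer (simp add: galrel_def limited_0)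
  show "x - y = x + - y"
    by transfer (simp add: galrel_def limited_0)
  show "x \<le> x"
    by transfer simp
  show "x \<le> y \<or> y \<le> x"
    by transfer (use linear in blast)
  show "x = y" if "x \<le> y" "y \<le> x"
    using that
  proof transfer
    fix s t :: 'a
    assume "s \<le> t \<or> limited (s - t)" "t \<le> s \<or> limited (t - s)"
    moreover have "limited (t - s) \<longleftrightarrow> limited (s - t)"
      by (metis limited_uminus minus_diff_eq)
    ultimately show "galrel s t"
      unfolding galrel_def using limited_0 by fastforce
  qed
  show "x \<le> z" if "x \<le> y" "y \<le> z"
    using that
  proof transfer
    fix s t u :: 'a
    assume st: "s \<le> t \<or> limited (s - t)" and tu: "t \<le> u \<or> limited (t - u)"
    show "s \<le> u \<or> limited (s - u)"
    proof (rule ccontr)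
      assume "\<not> ?thesis"
      then have gt: "s - u \<ge> 0" and nl: "\<not> limited (s - u)" by auto
      show False
      proof (cases "s \<le> t")
        case True
        then have "limited (t - u) \<and> s - u \<le> t - u" using gt tu nl
          by (metis antisym diff_ge_0_iff_ge diff_right_mono order_trans limited_0 diff_self)
        then show False using limited_between[OF limited_0 _ gt] nl by blast
      next
        case False
        then have l: "limited (s - t)" using st by blast
        show False
        proof (cases "t \<le> u")
          case True
          then show False using limited_between[OF limited_0 l gt] nl by simp
        next
          case False
          then have "limited (t - u)" using tu by blast
          then show False using limited_add[OF l] nl by fastforce
        qed
      qed
    qed
  qed
  show "z + x \<le> z + y" if "x \<le> y"
    using that by transfer simp
qed

end

lemma Gal_le_iff: "Gal s \<le> Gal t \<longleftrightarrow> s \<le> t \<or> limited (s - t)"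
  by (rule less_eq_gal.abs_eq)

definition gal_scale_set :: "'k::linordered_field \<Rightarrow> 'k gal \<Rightarrow> 'k set" where
  "gal_scale_set \<gamma> \<tau> = {\<gamma> * s | s. Gal s = \<tau>}"

text \<open>The next two functions are meaningful only for limited \<open>\<gamma> > 0\<close> (and \<open>\<tau> > 0\<close> for \<open>pv_gal\<close>).\<close>

definition gal_smult :: "'k::linordered_field \<Rightarrow> 'k gal \<Rightarrow> 'k gal" (infixr "\<bullet>\<^sub>G" 75) where
  "\<gamma> \<bullet>\<^sub>G \<tau> = (THE \<sigma>. Gal ` gal_scale_set \<gamma> \<tau> = {\<sigma>})"

definition pv_gal :: "'k::{linordered_field, real_field} \<Rightarrow> 'k gal \<Rightarrow> ereal" where
  "pv_gal \<gamma> \<tau> = (THE v. pv ` gal_scale_set \<gamma> \<tau> = {v})"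

lemma gal_smult_Gal:
  assumes "limited \<gamma>"
  shows "\<gamma> \<bullet>\<^sub>G Gal t = Gal (\<gamma> * t)"
proof -
  have "Gal (\<gamma> * s) = Gal (\<gamma> * t)" if "Gal s = Gal t" for s
    using that limited_mult[OF assms, of "s - t"]
    by (simp add: Gal_eq_iff right_diff_distrib)
  then have "Gal ` gal_scale_set \<gamma> (Gal t) = {Gal (\<gamma> * t)}"
    unfolding gal_scale_set_def by blast
  then show ?thesis
    unfolding gal_smult_def by simp
qed


section \<open>Galactic spaces\<close>

definition general_metric_rule ::
  "'x set \<Rightarrow> ('x \<Rightarrow> 'x \<Rightarrow> 'g::ordered_comm_monoid_add) \<Rightarrow> bool" where
  "general_metric_rule X d \<longleftrightarrow>
     (\<forall>x\<in>X. d x x = 0) \<and>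
     (\<forall>x\<in>X. \<forall>y\<in>X. x \<noteq> y \<longrightarrow> d x y = d y x \<and> d x y > 0) \<and>
     (\<forall>x\<in>X. \<forall>y\<in>X. \<forall>z\<in>X. d x z \<le> d x y + d y z)"

definition generalized_distance :: "'a set \<Rightarrow> ('a \<Rightarrow> 'a \<Rightarrow> ereal) \<Rightarrow> bool" where
  "generalized_distance F \<delta> \<longleftrightarrow> (\<forall>x\<in>F. \<forall>y\<in>F. \<delta> x y \<ge> 0) \<and> general_metric_rule F \<delta>"

definition galactic_distance ::
  "'e set \<Rightarrow> ('e \<Rightarrow> 'e \<Rightarrow> 'k::linordered_field gal) \<Rightarrow> bool" where
  "galactic_distance E \<Delta> \<longleftrightarrow> (\<forall>x\<in>E. \<forall>y\<in>E. \<Delta> x y \<ge> 0) \<and> general_metric_rule E \<Delta>"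

definition finite_dist_rel :: "'a set \<Rightarrow> ('a \<Rightarrow> 'a \<Rightarrow> ereal) \<Rightarrow> 'a rel" where
  "finite_dist_rel F \<delta> = {(x, y). x \<in> F \<and> y \<in> F \<and> \<delta> x y < \<infinity>}"

definition metric_components :: "'a set \<Rightarrow> ('a \<Rightarrow> 'a \<Rightarrow> ereal) \<Rightarrow> 'a set set" where
  "metric_components F \<delta> = F // finite_dist_rel F \<delta>"

definition component_of :: "'a set \<Rightarrow> ('a \<Rightarrow> 'a \<Rightarrow> ereal) \<Rightarrow> 'a \<Rightarrow> 'a set" where
  "component_of F \<delta> x = finite_dist_rel F \<delta> `` {x}"

type_synonym ('a, 'k) galactic_triple =
  "'a set \<times> ('a \<Rightarrow> 'a \<Rightarrow> ereal) \<times> ('a set \<Rightarrow> 'a set \<Rightarrow> 'k gal)"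

fun galactic_space :: "('a, 'k::linordered_field) galactic_triple \<Rightarrow> bool" where
  "galactic_space (F, \<delta>, \<Delta>) \<longleftrightarrow>
     generalized_distance F \<delta> \<and> galactic_distance (metric_components F \<delta>) \<Delta>"


section \<open>Morphisms and contractions\<close>

text \<open>
  \<open>le_scaled a \<gamma> b\<close> is the inequality \<open>a \<le> \<gamma> b\<close> in \<open>K \<union> {+\<infinity>}\<close>, for \<open>a, b\<close> nonnegative extended
  reals and \<open>\<gamma> > 0\<close>, where \<open>\<gamma> (+\<infinity>) = +\<infinity>\<close>. The comparison of finite values takes place in \<open>K\<close>.
\<close>

definition le_scaled :: "ereal \<Rightarrow> 'k::{linordered_field, real_field} \<Rightarrow> ereal \<Rightarrow> bool" where
  "le_scaled a \<gamma> b \<longleftrightarrow>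
     b = \<infinity> \<or> (a \<noteq> \<infinity> \<and> of_real (real_of_ereal a) \<le> \<gamma> * of_real (real_of_ereal b))"

definition induced_map ::
  "'b set \<Rightarrow> ('b \<Rightarrow> 'b \<Rightarrow> ereal) \<Rightarrow> ('a \<Rightarrow> 'b) \<Rightarrow> 'a set \<Rightarrow> 'b set" where
  "induced_map F' \<delta>' f E = (THE E'. E' \<in> metric_components F' \<delta>' \<and> f ` E \<subseteq> E')"

fun galactic_morphism ::
  "('a, 'k::{linordered_field, real_field}) galactic_triple \<Rightarrow> ('b, 'k) galactic_triple \<Rightarrow>
   ('a \<Rightarrow> 'b) \<Rightarrow> bool" where
  "galactic_morphism (F, \<delta>, \<Delta>) (F', \<delta>', \<Delta>') f \<longleftrightarrow>
     f ` F \<subseteq> F' \<and>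
     (\<exists>\<gamma>::'k. limited \<gamma> \<and> \<gamma> > 0 \<and>
        (\<forall>x\<^sub>1\<in>F. \<forall>x\<^sub>2\<in>F. le_scaled (\<delta>' (f x\<^sub>1) (f x\<^sub>2)) \<gamma> (\<delta> x\<^sub>1 x\<^sub>2)) \<and>
        (\<forall>E\<^sub>1\<in>metric_components F \<delta>. \<forall>E\<^sub>2\<in>metric_components F \<delta>.
           \<Delta>' (induced_map F' \<delta>' f E\<^sub>1) (induced_map F' \<delta>' f E\<^sub>2) \<le> \<gamma> \<bullet>\<^sub>G \<Delta> E\<^sub>1 E\<^sub>2))"

fun galactic_contraction ::
  "'k::{linordered_field, real_field} \<Rightarrow> ('a, 'k) galactic_triple \<Rightarrow> ('b, 'k) galactic_triple \<Rightarrow>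
   ('a \<Rightarrow> 'b) \<Rightarrow> bool" where
  "galactic_contraction \<gamma> (F, \<delta>, \<Delta>) (F', \<delta>', \<Delta>') f \<longleftrightarrow>
     galactic_morphism (F, \<delta>, \<Delta>) (F', \<delta>', \<Delta>') f \<and>
     f ` F = F' \<and>
     (\<forall>x\<^sub>1\<in>F. \<forall>x\<^sub>2\<in>F. \<delta> x\<^sub>1 x\<^sub>2 < \<infinity> \<longrightarrow>
        \<delta>' (f x\<^sub>1) (f x\<^sub>2) = pv (\<gamma> * of_real (real_of_ereal (\<delta> x\<^sub>1 x\<^sub>2)))) \<and>
     (\<forall>x\<^sub>1\<in>F. \<forall>x\<^sub>2\<in>F. \<delta> x\<^sub>1 x\<^sub>2 = \<infinity> \<longrightarrow>
        \<delta>' (f x\<^sub>1) (f x\<^sub>2) = pv_gal \<gamma> (\<Delta> (component_of F \<delta> x\<^sub>1) (component_of F \<delta> x\<^sub>2))) \<and>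
     (\<forall>E\<^sub>1\<in>metric_components F \<delta>. \<forall>E\<^sub>2\<in>metric_components F \<delta>.
        \<Delta>' (induced_map F' \<delta>' f E\<^sub>1) (induced_map F' \<delta>' f E\<^sub>2) = \<gamma> \<bullet>\<^sub>G \<Delta> E\<^sub>1 E\<^sub>2)"

end

theory Submission
  imports Defs
begin

text \<open>
  Pick for \<open>x, y\<close> in \<open>F\<close> a representative \<open>P x y \<ge> 0\<close> in the field: the distance \<open>\<delta> x y\<close> if it is
  finite, and any representative of the galaxy \<open>\<Delta> (C x) (C y)\<close> otherwise. Then \<open>pv (\<gamma> P)\<close> is a
  pseudo-distance and \<open>Gal (\<gamma> P)\<close> a galactic pseudo-distance on \<open>F\<close>, and the latter vanishes
  exactly where the former is finite, so that both descend to the quotient of \<open>F\<close> by the relation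
  \<open>pv (\<gamma> P) = 0\<close>. The representatives satisfy the triangle inequality only up to a limited error
  as soon as an infinite distance is involved. If \<open>\<gamma>\<close> is infinitely small, then this error becomes
  infinitely small and disappears under \<open>pv\<close>; if not, then \<open>\<gamma>\<close> times an infinitely large element
  is infinitely large and the upper bound is \<open>\<infinity>\<close>.
\<close>

section \<open>Principal values\<close>

lemma of_real_nonneg_iff:
  "(0 :: 'k::{linordered_field, real_field}) \<le> of_real r \<longleftrightarrow> 0 \<le> r"
  using of_real_le_iff_ordered_field[of 0 r, where ?'k = 'k] by simp

lemma of_real_less_iff_ordered_field:
  "(of_real r :: 'k::{linordered_field, real_field}) < of_real s \<longleftrightarrow> r < s"
  by (simp add: of_real_le_iff_ordered_field flip: not_le)

lemma limited_of_real: "limited (of_real r :: 'k::{linordered_field, real_field})"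
proof -
  obtain n :: nat where n: "\<bar>r\<bar> \<le> real n"
    using real_arch_simple by blast
  then have "(of_real r :: 'k) \<le> of_real (real n)" "of_real (- real n) \<le> (of_real r :: 'k)"
    unfolding of_real_le_iff_ordered_field by linarith+
  then have "\<bar>of_real r :: 'k\<bar> \<le> of_nat n"
    by (simp add: abs_le_iff)
  then show ?thesis
    unfolding limited_iff by blast
qed

lemma limited_if_abs_le: "\<bar>s\<bar> \<le> t \<Longrightarrow> limited t \<Longrightarrow> limited s"
  unfolding limited_iff by (meson abs_ge_self order_trans)

text \<open>Real bounds \<open>e\<close> replace the bounds \<open>1 / n\<close> so that later
  estimates can split \<open>e\<close> into halves. The equivalence rests on the Archimedean
  property of the reals.\<close>

lemma inf_small_iff:
  fixes s :: "'k::{linordered_field, real_field}"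
  shows "inf_small s \<longleftrightarrow> (\<forall>e>0. \<bar>s\<bar> \<le> of_real e)"
proof
  assume s: "inf_small s"
  show "\<forall>e>0. \<bar>s\<bar> \<le> of_real e"
  proof (intro allI impI)
    fix e :: real assume "e > 0"
    then obtain n where n: "n \<ge> 1" "1 / real n < e"
      by (metis Suc_le_eq inverse_eq_divide One_nat_def ex_inverse_of_nat_less)
    have "\<bar>s\<bar> < of_real (1 / real n)"
      using s n(1) by (simp add: inf_small_def)
    also have "\<dots> < of_real e"
      using n(2) by (simp only: of_real_less_iff_ordered_field)
    finally show "\<bar>s\<bar> \<le> of_real e" by simp
  qed
next
  assume s: "\<forall>e>0. \<bar>s\<bar> \<le> of_real e"
  show "inf_small s"
    unfolding inf_small_def
  proof (intro allI impI)
    fix n :: nat assume n: "n \<ge> 1"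
    \<comment> \<open>The factor 2 recovers a strict inequality from the weak bound.\<close>
    then have "1 / (2 * real n) > 0" by simp
    then have "\<bar>s\<bar> \<le> of_real (1 / (2 * real n))"
      using s by blast
    also have "\<dots> < of_real (1 / real n)"
      using n unfolding of_real_less_iff_ordered_field by (simp add: field_simps)
    finally show "\<bar>s\<bar> < 1 / of_nat n" by simp
  qed
qed

text \<open>The standard part is the supremum of the reals below \<open>s\<close>. Limitedness makes
  this set nonempty and bounded, and for every real \<open>e > 0\<close> the element
  \<open>s\<close> lies between \<open>Sup A - e\<close> and \<open>Sup A + e\<close>.\<close>

lemma ex_standard_part:
  fixes s :: "'k::{linordered_field, real_field}"
  assumes "limited s"
  shows "\<exists>r. s \<simeq> of_real r"
proof -
  obtain n :: nat where "\<bar>s\<bar> \<le> of_nat n"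
    using assms by (auto simp: limited_iff)
  then have n: "of_real (- real n) \<le> s" "s \<le> of_real (real n)"
    by (auto simp: abs_le_iff)
  define A where "A = {r. of_real r \<le> s}"
  have A: "- real n \<in> A" "\<And>r. r \<in> A \<Longrightarrow> r \<le> real n"
    using n by (auto simp: A_def intro: order_trans
        simp flip: of_real_le_iff_ordered_field[where ?'k = 'k])
  have bdd: "bdd_above A"
    using A(2) by (rule bdd_aboveI)
  have "\<bar>s - of_real (Sup A)\<bar> \<le> of_real e" if e: "e > 0" for e
  proof -
    have "Sup A + e \<notin> A"
      using cSup_upper[OF _ bdd, of "Sup A + e"] e by linarith
    then have "s \<le> of_real (Sup A + e)"
      by (simp add: A_def)
    moreover have "A \<noteq> {}" "Sup A - e < Sup A"
      using A(1) e by auto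
    then obtain r where "r \<in> A" "Sup A - e < r"
      using less_cSupD by blast
    then have "of_real r \<le> s" "of_real (Sup A - e) \<le> (of_real r :: 'k)"
      by (simp_all only: A_def mem_Collect_eq of_real_le_iff_ordered_field less_imp_le)
    then have "of_real (Sup A - e) \<le> s"
      by (rule order_trans[rotated])
    ultimately have "s \<le> of_real (Sup A) + of_real e" "of_real (Sup A) - of_real e \<le> s"
      by simp_all
    then show ?thesis
      unfolding abs_le_iff by linarith
  qed
  then show ?thesis
    unfolding inf_close_def inf_small_iff by blast
qed

lemma standard_part_unique:
  assumes "(s :: 'k::{linordered_field, real_field}) \<simeq> of_real r" "s \<simeq> of_real t"
  shows "r = t"
proof -
  have "\<bar>r - t\<bar> \<le> e" if "e > 0" for e
  proof -
    have "\<bar>s - of_real r\<bar> \<le> of_real (e / 2)" "\<bar>s - of_real t\<bar> \<le> of_real (e / 2)"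
      using assms that unfolding inf_close_def inf_small_iff by (meson half_gt_zero)+
    then have "of_real (r - t) \<le> (of_real (e / 2 + e / 2) :: 'k)"
      "of_real (t - r) \<le> (of_real (e / 2 + e / 2) :: 'k)"
      unfolding of_real_add of_real_diff by linarith+
    then show ?thesis
      unfolding of_real_le_iff_ordered_field by linarith
  qed
  then show ?thesis
    by (metis abs_le_zero_iff dense_ge eq_iff_diff_eq_0)
qed

lemma std_part_eqI: "s \<simeq> of_real r \<Longrightarrow> std_part s = r"
  unfolding std_part_def by (blast intro: the_equality standard_part_unique)

lemma inf_close_std_part: "limited s \<Longrightarrow> s \<simeq> of_real (std_part s)"
  using ex_standard_part std_part_eqI by metis

text \<open>Reduces upper bounds on principal values to inequalities in the field, for limited and
  infinitely large \<open>s\<close> alike. The margin \<open>e\<close> is there because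
  \<open>s\<close> may exceed its standard part by an infinitely small amount.\<close>

lemma pv_le_iff:
  fixes s :: "'k::{linordered_field, real_field}"
  shows "pv s \<le> ereal r \<longleftrightarrow> (\<forall>e>0. s \<le> of_real (r + e))"
proof (cases "limited s")
  case True
  have *: "\<bar>s - of_real (std_part s)\<bar> \<le> of_real e" if "e > 0" for e
    using inf_close_std_part[OF True] that unfolding inf_close_def inf_small_iff by blast
  have "std_part s \<le> r \<longleftrightarrow> (\<forall>e>0. s \<le> of_real (r + e))"
  proof safe
    fix e :: real assume "std_part s \<le> r" "e > 0"
    then have "s \<le> of_real (std_part s + e)" "of_real (std_part s + e) \<le> (of_real (r + e) :: 'k)"
      using *[of e] by (simp_all add: abs_le_iff algebra_simps of_real_le_iff_ordered_field)
    then show "s \<le> of_real (r + e)" by simp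
  next
    assume s: "\<forall>e>0. s \<le> of_real (r + e)"
    show "std_part s \<le> r"
    proof (rule field_le_epsilon)
      fix e :: real assume "e > 0"
      then have e: "e / 2 > 0" by simp
      have "s \<le> of_real (r + e / 2)"
        using s e by blast
      moreover have "of_real (std_part s) \<le> s + of_real (e / 2)"
        using *[OF e] by linarith
      ultimately have "of_real (std_part s) \<le> (of_real (r + e / 2 + e / 2) :: 'k)"
        unfolding of_real_add by linarith
      then show "std_part s \<le> r + e"
        unfolding of_real_le_iff_ordered_field by simp
    qed
  qed
  with True show ?thesis by (simp add: pv_def)
next
  case False
  \<comment> \<open>A positive infinitely large \<open>s\<close> exceeds every real, so
    \<open>e = 1\<close> already refutes the right-hand side; a negative one lies below every
    real.\<close>
  have "\<not> s \<le> of_real (r + 1)" if "s > 0"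
    using limited_if_abs_le[of s "of_real (r + 1)"] limited_of_real[of "r + 1"] False that
    by (metis abs_of_pos)
  moreover have "s \<le> of_real t" if "\<not> s > 0" for t
  proof (rule ccontr)
    assume "\<not> ?thesis"
    then have "\<bar>s\<bar> \<le> of_real (- t)" using that by simp
    then show False
      using limited_if_abs_le limited_of_real False by blast
  qed
  ultimately show ?thesis
    using False by (cases "s > 0") (auto simp: pv_def intro: exI[of _ 1] simp del: of_real_add)
qed

text \<open>The error \<open>s\<close> is invisible to \<open>pv\<close>: in the margin
  \<open>e\<close>, one half serves the bound on \<open>b\<close> and the other absorbs
  \<open>s\<close>. Extended reals are compared through their real upper bounds.\<close>

lemma pv_mono_inf_small:
  assumes "a \<le> b + s" "inf_small s"
  shows "pv a \<le> pv b"
proof (rule ereal_le_real)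
  fix r assume r: "pv b \<le> ereal r"
  have "a \<le> of_real (r + e)" if "e > 0" for e
  proof -
    have "b \<le> of_real (r + e / 2)" "s \<le> of_real (e / 2)"
      using r assms(2) that unfolding pv_le_iff inf_small_iff
      by (meson half_gt_zero abs_le_D1)+
    then have "a \<le> of_real (r + e / 2 + e / 2)"
      using assms(1) unfolding of_real_add by linarith
    then show ?thesis by simp
  qed
  then show "pv a \<le> ereal r"
    unfolding pv_le_iff by blast
qed

lemma inf_small_0: "inf_small 0"
  by (simp add: inf_small_def)

lemma pv_mono: "a \<le> b \<Longrightarrow> pv a \<le> pv b"
  using pv_mono_inf_small[OF _ inf_small_0] by simp

lemma pv_of_real: "pv (of_real r :: 'k::{linordered_field, real_field}) = ereal r"
proof -
  have "std_part (of_real r :: 'k) = r"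
    by (rule std_part_eqI) (simp add: inf_close_def inf_small_0)
  then show ?thesis
    by (simp add: pv_def limited_of_real)
qed

lemma pv_0: "pv 0 = 0"
  using pv_of_real[of 0] by (simp add: zero_ereal_def)

lemma pv_nonneg: "a \<ge> 0 \<Longrightarrow> pv a \<ge> 0"
  using pv_mono[of 0 a] by (simp add: pv_0)

lemma pv_less_PInf_iff: "a \<ge> 0 \<Longrightarrow> pv a < \<infinity> \<longleftrightarrow> limited a"
  using limited_0 by (cases "a = 0") (auto simp: pv_def)

text \<open>For limited summands the margin is split in halves. Otherwise nonnegativity forces the
  value \<infinity> on the right.\<close>

lemma pv_add_le:
  assumes "a \<ge> 0" "b \<ge> 0"
  shows "pv (a + b) \<le> pv a + pv b"
proof (cases "limited a \<and> limited b")
  case True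
  then have ab: "pv a = ereal (std_part a)" "pv b = ereal (std_part b)"
    by (simp_all add: pv_def)
  have "a + b \<le> of_real (std_part a + std_part b + e)" if "e > 0" for e
  proof -
    have "a \<le> of_real (std_part a + e / 2)" "b \<le> of_real (std_part b + e / 2)"
      using ab that pv_le_iff half_gt_zero order_refl by metis+
    then have "a + b \<le> of_real ((std_part a + e / 2) + (std_part b + e / 2))"
      unfolding of_real_add[of "_ + _"] by (rule add_mono)
    then show ?thesis by (simp add: algebra_simps)
  qed
  then show ?thesis
    unfolding ab plus_ereal.simps pv_le_iff by blast
next
  case False
  then have "pv a = \<infinity> \<or> pv b = \<infinity>"
    using assms pv_less_PInf_iff ereal_infty_less(1) by blast
  then show ?thesis
    using pv_nonneg[OF assms(1)] pv_nonneg[OF assms(2)] by auto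
qed

section \<open>Products with infinitely small and infinitely large factors\<close>

lemma inf_small_mult_limited:
  assumes "inf_small (g :: 'k::{linordered_field, real_field})" "limited s"
  shows "inf_small (g * s)"
  unfolding inf_small_iff
proof (intro allI impI)
  fix e :: real assume e: "e > 0"
  obtain n :: nat where n: "\<bar>s\<bar> \<le> of_nat n"
    using assms(2) by (auto simp: limited_iff)
  \<comment> \<open>\<open>Suc n\<close> instead of \<open>n\<close> avoids a division by zero when
    the bound on \<open>s\<close> is 0.\<close>
  have "e / real (Suc n) > 0"
    using e by simp
  then have "\<bar>g\<bar> \<le> of_real (e / real (Suc n))"
    using assms(1) unfolding inf_small_iff by blast
  then have "\<bar>g\<bar> * \<bar>s\<bar> \<le> of_real (e / real (Suc n)) * of_nat n"
    using n by (intro mult_mono) (auto intro: order_trans[OF abs_ge_zero])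
  also have "\<dots> = of_real (e / real (Suc n) * real n)"
    by simp
  also have "\<dots> \<le> of_real e"
    unfolding of_real_le_iff_ordered_field using e by (simp add: field_simps)
  finally show "\<bar>g * s\<bar> \<le> of_real e"
    by (simp add: abs_mult)
qed

text \<open>If \<open>g\<close> were not infinitely small, some \<open>n\<close> would give
  \<open>1 \<le> n * \<bar>g\<bar>\<close>, and a bound on \<open>g * s\<close> would then bound
  \<open>s\<close>. Contrapositively, a factor that is not infinitely small keeps infinitely large
  elements infinitely large.\<close>

lemma inf_small_if_limited_mult:
  assumes "limited (g * s)" "\<not> limited s"
  shows "inf_small g"
  unfolding inf_small_def
proof (intro allI impI)
  fix n :: nat assume n: "n \<ge> 1"
  obtain m :: nat where m: "\<bar>g\<bar> * \<bar>s\<bar> \<le> of_nat m"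
    using assms(1) by (auto simp: limited_iff abs_mult)
  have s: "\<bar>s\<bar> > of_nat (n * m)"
    using assms(2) unfolding limited_iff not_le by (meson not_le)
  show "\<bar>g\<bar> < 1 / of_nat n"
  proof (rule ccontr)
    assume "\<not> ?thesis"
    then have "1 \<le> of_nat n * \<bar>g\<bar>"
      using n by (simp add: field_simps)
    then have "\<bar>s\<bar> \<le> of_nat n * \<bar>g\<bar> * \<bar>s\<bar>"
      using mult_right_mono[of 1 "of_nat n * \<bar>g\<bar>" "\<bar>s\<bar>"] by simp
    also have "\<dots> \<le> of_nat n * of_nat m"
      using mult_left_mono[OF m, of "of_nat n"] by (simp add: mult.assoc)
    finally show False using s by simp
  qed
qed

text \<open>Justifies the definite description in \<open>pv_gal\<close>. Representatives differ by a
  limited amount, which an infinitely small \<gamma> makes infinitely small; for any other \<gamma>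
  both products are positive and infinitely large, hence have value \<infinity>.\<close>

lemma pv_gal_Gal:
  assumes "\<gamma> > 0" "t \<ge> 0" "\<not> limited t"
  shows "pv_gal \<gamma> (Gal t) = pv (\<gamma> * t)"
proof -
  have "pv (\<gamma> * s) = pv (\<gamma> * t)" if "Gal s = Gal t" for s
  proof -
    have st: "limited (s - t)"
      using that by (simp add: Gal_eq_iff)
    then have "\<not> limited s"
      using assms(3) limited_add[of s "- (s - t)"] by (auto simp: limited_uminus simp del: minus_diff_eq)
    \<comment> \<open>A limited shift cannot carry \<open>t\<close> across zero, since the shift
      would have to be at least as large as \<open>t\<close>.\<close>
    have "s > 0"
    proof (rule ccontr)
      assume "\<not> s > 0"
      then have "\<bar>t\<bar> \<le> \<bar>s - t\<bar>" using assms(2) by simp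
      then show False
        using st assms(3) limited_if_abs_le[of t "\<bar>s - t\<bar>"] by (simp add: limited_iff)
    qed
    show ?thesis
    proof (cases "inf_small \<gamma>")
      case True
      have "limited (t - s)"
        using st limited_uminus[of "s - t"] by simp
      with st True have "inf_small (\<gamma> * (s - t))" "inf_small (\<gamma> * (t - s))"
        by (simp_all only: inf_small_mult_limited)
      then show ?thesis
        using pv_mono_inf_small[of "\<gamma> * s" "\<gamma> * t" "\<gamma> * (s - t)"]
          pv_mono_inf_small[of "\<gamma> * t" "\<gamma> * s" "\<gamma> * (t - s)"]
        by (simp add: right_diff_distrib)
    next
      case False
      then have "\<not> limited (\<gamma> * s)" "\<not> limited (\<gamma> * t)"
        using inf_small_if_limited_mult \<open>\<not> limited s\<close> assms(3) by blast+
      moreover have "t > 0"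
        using assms(2,3) limited_0 by (metis order_le_less)
      ultimately show ?thesis
        using \<open>s > 0\<close> assms(1) by (simp add: pv_def)
    qed
  qed
  then have "pv ` gal_scale_set \<gamma> (Gal t) = {pv (\<gamma> * t)}"
    unfolding gal_scale_set_def by blast
  then show ?thesis
    unfolding pv_gal_def by simp
qed


section \<open>Galactic spaces and pseudo-distances\<close>

lemma ex_Gal: "\<exists>t. Gal t = \<tau>"
  using gal.abs_induct[of "\<lambda>\<tau>. \<exists>t. Gal t = \<tau>"] by blast

lemma Gal_0: "Gal 0 = 0"
  by (simp add: zero_gal_def)

lemma Gal_add: "Gal (s + t) = Gal s + Gal t"
  by (simp add: plus_gal.abs_eq)

lemma Gal_eq_0_iff: "Gal s = 0 \<longleftrightarrow> limited s"
  using Gal_eq_iff[of s 0] by (simp add: Gal_0)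

lemma Gal_mono: "s \<le> t \<Longrightarrow> Gal s \<le> Gal t"
  by (simp add: Gal_le_iff)

lemma Gal_less_imp_less: "Gal s < Gal t \<Longrightarrow> s < t"
  by (metis Gal_mono leD not_le)

lemma general_metric_ruleD:
  assumes "general_metric_rule X d"
  shows "x \<in> X \<Longrightarrow> d x x = 0"
    and "x \<in> X \<Longrightarrow> y \<in> X \<Longrightarrow> d x y = d y x"
    and "x \<in> X \<Longrightarrow> y \<in> X \<Longrightarrow> x \<noteq> y \<Longrightarrow> d x y > 0"
    and "x \<in> X \<Longrightarrow> y \<in> X \<Longrightarrow> z \<in> X \<Longrightarrow> d x z \<le> d x y + d y z"
  using assms unfolding general_metric_rule_def by metis+

section \<open>Metric components and induced maps on them\<close>

lemma equiv_finite_pseudo_distance: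
  fixes D :: "'a \<Rightarrow> 'a \<Rightarrow> ereal"
  assumes "\<And>x. x \<in> F \<Longrightarrow> D x x = 0"
    and "\<And>x y. x \<in> F \<Longrightarrow> y \<in> F \<Longrightarrow> D x y = D y x"
    and "\<And>x y z. x \<in> F \<Longrightarrow> y \<in> F \<Longrightarrow> z \<in> F \<Longrightarrow> D x z \<le> D x y + D y z"
  shows "equiv F (finite_dist_rel F D)"
proof (intro equivI)
  have "D x z < \<infinity>" if "x \<in> F" "y \<in> F" "z \<in> F" "D x y < \<infinity>" "D y z < \<infinity>" for x y z
  proof -
    have "D x y + D y z < \<infinity>"
      using that(4,5) by (cases "D x y"; cases "D y z") auto
    then show ?thesis
      using assms(3)[OF that(1-3)] by (rule le_less_trans[rotated])
  qed
  then show "trans (finite_dist_rel F D)"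
    unfolding finite_dist_rel_def trans_def by blast
  show "refl_on F (finite_dist_rel F D)"
    using assms(1) by (simp add: finite_dist_rel_def refl_on_def)
  show "sym (finite_dist_rel F D)"
    unfolding finite_dist_rel_def sym_def using assms(2) by fastforce
qed (auto simp: finite_dist_rel_def)

lemma generalized_distance_equiv:
  assumes "generalized_distance F \<delta>"
  shows "equiv F (finite_dist_rel F \<delta>)"
proof -
  have "general_metric_rule F \<delta>"
    using assms by (simp add: generalized_distance_def)
  note rules = general_metric_ruleD[OF this]
  show ?thesis
    by (rule equiv_finite_pseudo_distance) (fact rules)+
qed

lemma metric_components_eq: "metric_components F \<delta> = component_of F \<delta> ` F"
  by (auto simp: metric_components_def component_of_def quotient_def)

lemma component_of_eq_iff:
  assumes "generalized_distance F \<delta>" "x \<in> F" "y \<in> F"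
  shows "component_of F \<delta> x = component_of F \<delta> y \<longleftrightarrow> \<delta> x y < \<infinity>"
  using eq_equiv_class_iff[OF generalized_distance_equiv[OF assms(1)] assms(2,3)] assms(2,3)
  by (simp add: component_of_def finite_dist_rel_def)

text \<open>Preservation of finite distances sends the component of \<open>x\<close> into that of
  \<open>f x\<close>. No other component contains the image, because \<open>f x\<close> is in the
  image and components are equivalence classes.\<close>

lemma induced_map_component_of:
  assumes d: "generalized_distance F \<delta>" and d': "generalized_distance F' \<delta>'"
    and f: "f ` F \<subseteq> F'"
    and fin: "\<And>x y. x \<in> F \<Longrightarrow> y \<in> F \<Longrightarrow> \<delta> x y < \<infinity> \<Longrightarrow> \<delta>' (f x) (f y) < \<infinity>"
    and x: "x \<in> F"
  shows "induced_map F' \<delta>' f (component_of F \<delta> x) = component_of F' \<delta>' (f x)"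
  unfolding induced_map_def
proof (rule the_equality)
  have "f y \<in> component_of F' \<delta>' (f x)" if "y \<in> component_of F \<delta> x" for y
  proof -
    have "y \<in> F" "\<delta> x y < \<infinity>"
      using that by (simp_all add: component_of_def finite_dist_rel_def)
    then have "f x \<in> F'" "f y \<in> F'" "\<delta>' (f x) (f y) < \<infinity>"
      using f x fin by blast+
    then show ?thesis
      by (simp add: component_of_def finite_dist_rel_def)
  qed
  then show "component_of F' \<delta>' (f x) \<in> metric_components F' \<delta>' \<and>
      f ` component_of F \<delta> x \<subseteq> component_of F' \<delta>' (f x)"
    using f x unfolding metric_components_eq by blast
next
  fix E assume E: "E \<in> metric_components F' \<delta>' \<and> f ` component_of F \<delta> x \<subseteq> E"
  then obtain y where y: "y \<in> F'" "E = component_of F' \<delta>' y"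
    unfolding metric_components_eq by blast
  have "x \<in> component_of F \<delta> x"
    using equiv_class_self[OF generalized_distance_equiv[OF d] x] by (simp add: component_of_def)
  then have "f x \<in> component_of F' \<delta>' y"
    using E y by blast
  then show "E = component_of F' \<delta>' (f x)"
    using component_of_eq_iff[OF d', of y "f x"] y
    by (simp add: component_of_def finite_dist_rel_def)
qed

text \<open>Passing to the classes of \<open>D x y = 0\<close> separates points. The components of
  the quotient are the classes of \<open>D x y < \<infinity>\<close>; by \<open>Q_eq_0_iff\<close>
  these are the classes of \<open>Q x y = 0\<close>, so \<open>Q\<close> descends to them and
  separates them.\<close>

lemma ex_galactic_space_of_pseudo_distances:
  fixes D :: "'a \<Rightarrow> 'a \<Rightarrow> ereal" and Q :: "'a \<Rightarrow> 'a \<Rightarrow> 'k::linordered_field gal"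
  assumes D_refl: "\<And>x. x \<in> F \<Longrightarrow> D x x = 0"
    and D_sym: "\<And>x y. x \<in> F \<Longrightarrow> y \<in> F \<Longrightarrow> D x y = D y x"
    and D_tri: "\<And>x y z. x \<in> F \<Longrightarrow> y \<in> F \<Longrightarrow> z \<in> F \<Longrightarrow> D x z \<le> D x y + D y z"
    and D_nonneg: "\<And>x y. x \<in> F \<Longrightarrow> y \<in> F \<Longrightarrow> D x y \<ge> 0"
    and Q_sym: "\<And>x y. x \<in> F \<Longrightarrow> y \<in> F \<Longrightarrow> Q x y = Q y x"
    and Q_tri: "\<And>x y z. x \<in> F \<Longrightarrow> y \<in> F \<Longrightarrow> z \<in> F \<Longrightarrow> Q x z \<le> Q x y + Q y z"
    and Q_nonneg: "\<And>x y. x \<in> F \<Longrightarrow> y \<in> F \<Longrightarrow> Q x y \<ge> 0"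
    and Q_eq_0_iff: "\<And>x y. x \<in> F \<Longrightarrow> y \<in> F \<Longrightarrow> Q x y = 0 \<longleftrightarrow> D x y < \<infinity>"
  obtains F' :: "'a set set" and \<delta>' \<Delta>' f where
    "galactic_space (F', \<delta>', \<Delta>')" "f ` F = F'"
    "\<And>x y. x \<in> F \<Longrightarrow> y \<in> F \<Longrightarrow> \<delta>' (f x) (f y) = D x y"
    "\<And>x y. x \<in> F \<Longrightarrow> y \<in> F \<Longrightarrow>
       \<Delta>' (component_of F' \<delta>' (f x)) (component_of F' \<delta>' (f y)) = Q x y"
proof -
  define f where "f x = {y \<in> F. D x y = 0}" for x
  \<comment> \<open>\<open>g\<close> chooses a representative of each class; \<open>D_cong\<close>
    below makes the resulting distance independent of the choice.\<close>
  define g where "g X = (SOME x. x \<in> F \<and> f x = X)" for X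
  define F' where "F' = f ` F"
  define \<delta>' where "\<delta>' X Y = D (g X) (g Y)" for X Y
  have D_cong: "D x z = D y z" if "x \<in> F" "y \<in> F" "z \<in> F" "D x y = 0" for x y z
  proof (rule antisym)
    show "D x z \<le> D y z"
      using D_tri[OF that(1-3)] that(4) by simp
    show "D y z \<le> D x z"
      using D_tri[OF that(2,1,3)] D_sym[OF that(1,2)] that(4) by simp
  qed
  have f_eq_iff: "f x = f y \<longleftrightarrow> D x y = 0" if "x \<in> F" "y \<in> F" for x y
  proof
    assume "f x = f y"
    then have "y \<in> f x"
      using that D_refl by (auto simp: f_def)
    then show "D x y = 0" by (simp add: f_def)
  next
    assume "D x y = 0"
    then show "f x = f y"
      using D_cong[OF that] by (auto simp: f_def)
  qed
  have g: "g (f x) \<in> F" "D (g (f x)) x = 0" if "x \<in> F" for x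
  proof -
    have "g (f x) \<in> F \<and> f (g (f x)) = f x"
      unfolding g_def by (rule someI[of "\<lambda>z. z \<in> F \<and> f z = f x" x]) (simp add: that)
    then show "g (f x) \<in> F" "D (g (f x)) x = 0"
      using f_eq_iff that by blast+
  qed
  have \<delta>': "\<delta>' (f x) (f y) = D x y" if "x \<in> F" "y \<in> F" for x y
  proof -
    have "D (g (f x)) (g (f y)) = D x (g (f y))"
      by (rule D_cong) (use g that in auto)
    also have "\<dots> = D (g (f y)) x"
      using g that D_sym by blast
    also have "\<dots> = D y x"
      by (rule D_cong) (use g that in auto)
    finally show ?thesis
      using that D_sym by (simp add: \<delta>'_def)
  qed
  have dist': "generalized_distance F' \<delta>'"
    unfolding generalized_distance_def general_metric_rule_def F'_def
  proof (intro conjI ballI impI; elim imageE; hypsubst)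
    fix x y assume xy: "x \<in> F" "y \<in> F"
    show "0 \<le> \<delta>' (f x) (f y)"
      using xy by (simp add: \<delta>' D_nonneg)
    show "\<delta>' (f x) (f y) = \<delta>' (f y) (f x)"
      using xy by (simp add: \<delta>' D_sym)
    assume "f x \<noteq> f y"
    then show "0 < \<delta>' (f x) (f y)"
      using xy D_nonneg[OF xy] \<delta>'[OF xy] f_eq_iff[OF xy] by (metis order_le_less)
  qed (auto simp: \<delta>' D_refl D_tri)
  define C where "C x = component_of F' \<delta>' (f x)" for x
  \<comment> \<open>\<open>h\<close> chooses a point of the original \<open>F\<close>, not of the
    quotient, so that \<open>Q\<close> can be evaluated at it directly.\<close>
  define h where "h E = (SOME x. x \<in> F \<and> C x = E)" for E
  define \<Delta>' where "\<Delta>' A B = Q (h A) (h B)" for A B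
  have Q_cong: "Q x z = Q y z" if "x \<in> F" "y \<in> F" "z \<in> F" "Q x y = 0" for x y z
  proof (rule antisym)
    show "Q x z \<le> Q y z"
      using Q_tri[OF that(1-3)] that(4) by simp
    show "Q y z \<le> Q x z"
      using Q_tri[OF that(2,1,3)] Q_sym[OF that(1,2)] that(4) by simp
  qed
  have C_eq_iff: "C x = C y \<longleftrightarrow> Q x y = 0" if "x \<in> F" "y \<in> F" for x y
    using component_of_eq_iff[OF dist', of "f x" "f y"] that
    by (simp add: C_def F'_def \<delta>' Q_eq_0_iff)
  have h: "h (C x) \<in> F" "Q (h (C x)) x = 0" if "x \<in> F" for x
  proof -
    have "h (C x) \<in> F \<and> C (h (C x)) = C x"
      unfolding h_def by (rule someI[of "\<lambda>z. z \<in> F \<and> C z = C x" x]) (simp add: that)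
    then show "h (C x) \<in> F" "Q (h (C x)) x = 0"
      using C_eq_iff that by blast+
  qed
  have \<Delta>': "\<Delta>' (C x) (C y) = Q x y" if "x \<in> F" "y \<in> F" for x y
  proof -
    have "Q (h (C x)) (h (C y)) = Q x (h (C y))"
      by (rule Q_cong) (use h that in auto)
    also have "\<dots> = Q (h (C y)) x"
      using h that Q_sym by blast
    also have "\<dots> = Q y x"
      by (rule Q_cong) (use h that in auto)
    finally show ?thesis
      using that Q_sym by (simp add: \<Delta>'_def)
  qed
  have "metric_components F' \<delta>' = C ` F"
    by (auto simp: metric_components_eq F'_def C_def)
  moreover have "galactic_distance (C ` F) \<Delta>'"
    unfolding galactic_distance_def general_metric_rule_def
  proof (intro conjI ballI impI; elim imageE; hypsubst)
    fix x y assume xy: "x \<in> F" "y \<in> F"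
    show "0 \<le> \<Delta>' (C x) (C y)"
      using xy by (simp add: \<Delta>' Q_nonneg)
    show "\<Delta>' (C x) (C y) = \<Delta>' (C y) (C x)"
      using xy by (simp add: \<Delta>' Q_sym)
    assume "C x \<noteq> C y"
    then show "0 < \<Delta>' (C x) (C y)"
      using xy Q_nonneg[OF xy] \<Delta>'[OF xy] C_eq_iff[OF xy] by (metis order_le_less)
  qed (auto simp: \<Delta>' D_refl Q_tri Q_eq_0_iff)
  ultimately have "galactic_space (F', \<delta>', \<Delta>')"
    using dist' by simp
  from that[OF this _ \<delta>' \<Delta>'[unfolded C_def]] show thesis
    by (simp add: F'_def)
qed


section \<open>Existence of contractions\<close>

text \<open>Encodes both distances in a single function with values in the field: its galaxy gives
  \<Delta>, and its value, where limited, gives \<delta>. The finite and infinite cases of a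
  contraction can then be treated by one formula.\<close>

lemma ex_galactic_representatives:
  fixes \<Delta> :: "'a set \<Rightarrow> 'a set \<Rightarrow> 'k::{linordered_field, real_field} gal"
  assumes "galactic_space (F, \<delta>, \<Delta>)"
  obtains P :: "'a \<Rightarrow> 'a \<Rightarrow> 'k" where
    "\<And>x y. x \<in> F \<Longrightarrow> y \<in> F \<Longrightarrow> P x y \<ge> 0"
    "\<And>x y. x \<in> F \<Longrightarrow> y \<in> F \<Longrightarrow> P x y = P y x"
    "\<And>x y. x \<in> F \<Longrightarrow> y \<in> F \<Longrightarrow> Gal (P x y) = \<Delta> (component_of F \<delta> x) (component_of F \<delta> y)"
    "\<And>x y. x \<in> F \<Longrightarrow> y \<in> F \<Longrightarrow> limited (P x y) \<longleftrightarrow> \<delta> x y < \<infinity>"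
    "\<And>x y. x \<in> F \<Longrightarrow> y \<in> F \<Longrightarrow> \<delta> x y < \<infinity> \<Longrightarrow> P x y = of_real (real_of_ereal (\<delta> x y))"
proof -
  define C where "C = component_of F \<delta>"
  define rep :: "'k gal \<Rightarrow> 'k" where "rep \<tau> = (SOME t. Gal t = \<tau>)" for \<tau>
  have rep: "Gal (rep \<tau>) = \<tau>" for \<tau>
    unfolding rep_def using someI_ex[OF ex_Gal] .
  \<comment> \<open>\<open>rep\<close> depends only on the galaxy, not on the pair of points, so
    \<open>P\<close> inherits symmetry from \<Delta>.\<close>
  define P where
    "P x y = (if \<delta> x y < \<infinity> then of_real (real_of_ereal (\<delta> x y)) else rep (\<Delta> (C x) (C y)))" for x y
  have d: "generalized_distance F \<delta>" and gd: "galactic_distance (C ` F) \<Delta>"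
    using assms by (simp_all add: metric_components_eq C_def)
  have dr: "general_metric_rule F \<delta>" and nonneg: "\<And>x y. x \<in> F \<Longrightarrow> y \<in> F \<Longrightarrow> \<delta> x y \<ge> 0"
    and gr: "general_metric_rule (C ` F) \<Delta>"
    using d gd by (auto simp: generalized_distance_def galactic_distance_def)
  note d_rules = general_metric_ruleD[OF dr] and gal_rules = general_metric_ruleD[OF gr]
  have C_eq_iff: "C x = C y \<longleftrightarrow> \<delta> x y < \<infinity>" if "x \<in> F" "y \<in> F" for x y
    unfolding C_def using component_of_eq_iff[OF d that] .
  have \<Delta>_pos: "\<Delta> (C x) (C y) > 0" if "x \<in> F" "y \<in> F" "\<not> \<delta> x y < \<infinity>" for x y
    using gal_rules(3)[of "C x" "C y"] C_eq_iff that by blast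
  have lim: "limited (P x y) \<longleftrightarrow> \<delta> x y < \<infinity>" if "x \<in> F" "y \<in> F" for x y
  proof (cases "\<delta> x y < \<infinity>")
    case False
    then have "Gal (P x y) \<noteq> 0"
      using \<Delta>_pos[OF that] by (simp add: P_def rep)
    with False show ?thesis
      by (simp add: Gal_eq_0_iff)
  qed (simp add: P_def limited_of_real)
  have Gal_P: "Gal (P x y) = \<Delta> (C x) (C y)" if "x \<in> F" "y \<in> F" for x y
  proof (cases "\<delta> x y < \<infinity>")
    case True
    then have "\<Delta> (C x) (C y) = 0"
      using gal_rules(1)[of "C x"] C_eq_iff[OF that] that by simp
    then show ?thesis
      using lim[OF that] True by (simp add: Gal_eq_0_iff)
  qed (simp add: P_def rep)
  have sym: "P x y = P y x" if "x \<in> F" "y \<in> F" for x y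
    using d_rules(2)[OF that] gal_rules(2)[of "C x" "C y"] that by (simp add: P_def)
  have P_nonneg: "P x y \<ge> 0" if "x \<in> F" "y \<in> F" for x y
  proof (cases "\<delta> x y < \<infinity>")
    case True
    then show ?thesis
      using nonneg[OF that] by (simp add: P_def of_real_nonneg_iff real_of_ereal_pos)
  next
    case False
    \<comment> \<open>A positive galaxy contains only positive elements, so the sign of the
      arbitrary representative is settled.\<close>
    then have "Gal 0 < Gal (P x y)"
      using \<Delta>_pos[OF that] Gal_P[OF that] by (simp add: Gal_0)
    then show ?thesis
      using Gal_less_imp_less by (blast intro: less_imp_le)
  qed
  from that[of P] show thesis
    using P_nonneg sym Gal_P lim by (auto simp: C_def P_def)
qed

text \<open>If \<open>r\<close> exceeds \<open>p + q\<close>, then \<open>gal\<close> makes the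
  excess limited, and an infinitely small \<gamma> removes it under \<open>pv\<close>. For any other
  \<gamma>, \<open>finite\<close> leaves only the case that \<open>p\<close> or \<open>q\<close> is
  infinitely large, where the right-hand side is \<infinity>.\<close>

lemma pv_scaled_triangle:
  fixes p q r \<gamma> :: "'k::{linordered_field, real_field}"
  assumes "\<gamma> > 0" "p \<ge> 0" "q \<ge> 0"
    and finite: "limited p \<Longrightarrow> limited q \<Longrightarrow> r \<le> p + q"
    and gal: "Gal r \<le> Gal p + Gal q"
  shows "pv (\<gamma> * r) \<le> pv (\<gamma> * p) + pv (\<gamma> * q)"
proof -
  have pq: "\<gamma> * p \<ge> 0" "\<gamma> * q \<ge> 0"
    using assms(1-3) by simp_all
  consider "r \<le> p + q" | "inf_small \<gamma>" "\<not> r \<le> p + q"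
    | "\<not> inf_small \<gamma>" "\<not> limited p \<or> \<not> limited q"
    using finite by blast
  then show ?thesis
  proof cases
    case 1
    then have "\<gamma> * r \<le> \<gamma> * p + \<gamma> * q"
      using assms(1) by (simp flip: distrib_left)
    then show ?thesis
      using pv_mono pv_add_le[OF pq] order_trans by blast
  next
    case 2
    then have "limited (r - (p + q))"
      using gal by (simp add: Gal_le_iff flip: Gal_add)
    then have "inf_small (\<gamma> * (r - (p + q)))"
      using 2 inf_small_mult_limited by blast
    then have "pv (\<gamma> * r) \<le> pv (\<gamma> * p + \<gamma> * q)"
      by (rule pv_mono_inf_small[rotated]) (simp add: algebra_simps)
    then show ?thesis
      using pv_add_le[OF pq] order_trans by blast
  next
    case 3
    then have "\<not> limited (\<gamma> * p) \<or> \<not> limited (\<gamma> * q)"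
      using inf_small_if_limited_mult by blast
    then have "pv (\<gamma> * p) = \<infinity> \<or> pv (\<gamma> * q) = \<infinity>"
      using pq pv_less_PInf_iff ereal_infty_less(1) by blast
    then show ?thesis
      using pv_nonneg[OF pq(1)] pv_nonneg[OF pq(2)] by auto
  qed
qed

text \<open>The factor \<open>\<gamma>\<close> itself does not do, since \<open>pv (\<gamma> * d)\<close> may exceed \<open>\<gamma> * d\<close> by an infinitely
  small amount.\<close>

lemma le_scaled_pv:
  assumes "limited \<gamma>" "\<gamma> > 0" "b \<ge> 0"
    and b: "b < \<infinity> \<Longrightarrow> a = pv (\<gamma> * of_real (real_of_ereal b))"
  shows "le_scaled a (\<gamma> + 1) b"
proof (cases "b < \<infinity>")
  case True
  define d where "d = real_of_ereal b"
  define r where "r = std_part (\<gamma> * of_real d)"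
  have d: "d \<ge> 0"
    using assms(3) by (simp add: d_def real_of_ereal_pos)
  have l: "limited (\<gamma> * of_real d)"
    using assms(1) limited_mult limited_of_real by blast
  then have a: "a = ereal r"
    using b[OF True] by (simp add: pv_def r_def d_def)
  have "of_real r \<le> (\<gamma> + 1) * of_real d"
  proof (cases "d = 0")
    case True
    then have "r = 0"
      using a b[OF \<open>b < \<infinity>\<close>] by (simp add: pv_0 flip: d_def)
    then show ?thesis by (simp add: True)
  next
    case False
    then have "d > 0" using d by simp
    \<comment> \<open>The gap is infinitely small while \<open>d\<close> is a positive real, so the
      summand 1 in \<open>\<gamma> + 1\<close> absorbs it.\<close>
    then have "\<bar>\<gamma> * of_real d - of_real r\<bar> \<le> of_real d"
      using inf_close_std_part[OF l] unfolding r_def inf_close_def inf_small_iff by blast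
    then show ?thesis
      by (simp add: abs_le_iff algebra_simps)
  qed
  then show ?thesis
    by (simp add: le_scaled_def a d_def)
qed (simp add: le_scaled_def)

theorem theorem2:
  fixes F :: "'a set"
    and \<delta> :: "'a \<Rightarrow> 'a \<Rightarrow> ereal"
    and \<Delta> :: "'a set \<Rightarrow> 'a set \<Rightarrow> 'k::{linordered_field, real_field} gal"
    and \<gamma> :: 'k
  assumes "\<real> \<noteq> (UNIV :: 'k set)"
    and "galactic_space (F, \<delta>, \<Delta>)"
    and "limited \<gamma>" and "\<gamma> > 0"
  shows "\<exists>(F\<^sub>\<gamma> :: 'a set set) \<delta>\<^sub>\<gamma> (\<Delta>\<^sub>\<gamma> :: 'a set set \<Rightarrow> 'a set set \<Rightarrow> 'k gal) f\<^sub>\<gamma>.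
           galactic_space (F\<^sub>\<gamma>, \<delta>\<^sub>\<gamma>, \<Delta>\<^sub>\<gamma>) \<and>
           galactic_contraction \<gamma> (F, \<delta>, \<Delta>) (F\<^sub>\<gamma>, \<delta>\<^sub>\<gamma>, \<Delta>\<^sub>\<gamma>) f\<^sub>\<gamma>"
proof -
  define C where "C = component_of F \<delta>"
  obtain P :: "'a \<Rightarrow> 'a \<Rightarrow> 'k" where P_nonneg: "\<And>x y. x \<in> F \<Longrightarrow> y \<in> F \<Longrightarrow> P x y \<ge> 0"
    and P_sym: "\<And>x y. x \<in> F \<Longrightarrow> y \<in> F \<Longrightarrow> P x y = P y x"
    and Gal_P: "\<And>x y. x \<in> F \<Longrightarrow> y \<in> F \<Longrightarrow> Gal (P x y) = \<Delta> (C x) (C y)"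
    and lim_P: "\<And>x y. x \<in> F \<Longrightarrow> y \<in> F \<Longrightarrow> limited (P x y) \<longleftrightarrow> \<delta> x y < \<infinity>"
    and P_fin: "\<And>x y. x \<in> F \<Longrightarrow> y \<in> F \<Longrightarrow> \<delta> x y < \<infinity> \<Longrightarrow> P x y = of_real (real_of_ereal (\<delta> x y))"
    unfolding C_def by (rule ex_galactic_representatives[OF assms(2)]) blast
  have d: "generalized_distance F \<delta>" and gd: "galactic_distance (C ` F) \<Delta>"
    using assms(2) by (simp_all add: metric_components_eq C_def)
  have dr: "general_metric_rule F \<delta>" and nonneg: "\<And>x y. x \<in> F \<Longrightarrow> y \<in> F \<Longrightarrow> \<delta> x y \<ge> 0"
    and gr: "general_metric_rule (C ` F) \<Delta>"
    using d gd by (auto simp: generalized_distance_def galactic_distance_def)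
  note d_rules = general_metric_ruleD[OF dr] and gal_rules = general_metric_ruleD[OF gr]
  \<comment> \<open>Limited representatives are the embedded finite distances, so the real triangle
    inequality transfers exactly.\<close>
  have P_tri: "P x z \<le> P x y + P y z"
    if xyz: "x \<in> F" "y \<in> F" "z \<in> F" and "limited (P x y)" "limited (P y z)" for x y z
  proof -
    have fin: "\<delta> x y < \<infinity>" "\<delta> y z < \<infinity>"
      using that lim_P by auto
    have le: "\<delta> x z \<le> \<delta> x y + \<delta> y z"
      using d_rules(4) xyz .
    obtain a b where ab: "\<delta> x y = ereal a" "\<delta> y z = ereal b"
      using fin nonneg xyz by (metis ereal_cases ereal_infty_less(1) ereal_less_eq(2) MInfty_neq_ereal(1)
          ereal_infty_less_eq(2) zero_ereal_def)
    moreover from this obtain c where "\<delta> x z = ereal c"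
      using le nonneg[OF xyz(1,3)] by (cases "\<delta> x z") auto
    ultimately show ?thesis
      using le P_fin[OF xyz(1,2)] P_fin[OF xyz(2,3)] P_fin[OF xyz(1,3)]
      by (simp add: of_real_le_iff_ordered_field flip: of_real_add)
  qed
  have Gal_tri: "Gal (P x z) \<le> Gal (P x y) + Gal (P y z)" if "x \<in> F" "y \<in> F" "z \<in> F" for x y z
    using gal_rules(4)[of "C x" "C y" "C z"] Gal_P that by simp
  define D where "D x y = pv (\<gamma> * P x y)" for x y
  define Q where "Q x y = Gal (\<gamma> * P x y)" for x y
  have \<gamma>P_nonneg: "\<gamma> * P x y \<ge> 0" if "x \<in> F" "y \<in> F" for x y
    using assms(4) P_nonneg that by simp
  \<comment> \<open>Multiplication by \<gamma> preserves the order of galaxies: it is positive, and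
    being limited it keeps a limited error limited.\<close>
  have Q_tri: "Q x z \<le> Q x y + Q y z" if xyz: "x \<in> F" "y \<in> F" "z \<in> F" for x y z
  proof -
    have "P x z \<le> P x y + P y z \<or> limited (P x z - (P x y + P y z))"
      using Gal_tri[OF xyz] by (simp add: Gal_le_iff flip: Gal_add)
    then have "\<gamma> * P x z \<le> \<gamma> * (P x y + P y z) \<or> limited (\<gamma> * (P x z - (P x y + P y z)))"
      using assms(3,4) limited_mult by auto
    then show ?thesis
      by (simp add: Q_def Gal_le_iff distrib_left right_diff_distrib flip: Gal_add)
  qed
  obtain F' :: "'a set set" and \<delta>' \<Delta>' f where space': "galactic_space (F', \<delta>', \<Delta>')"
    and f: "f ` F = F'"
    and \<delta>': "\<And>x y. x \<in> F \<Longrightarrow> y \<in> F \<Longrightarrow> \<delta>' (f x) (f y) = D x y"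
    and \<Delta>': "\<And>x y. x \<in> F \<Longrightarrow> y \<in> F \<Longrightarrow>
       \<Delta>' (component_of F' \<delta>' (f x)) (component_of F' \<delta>' (f y)) = Q x y"
  proof (rule ex_galactic_space_of_pseudo_distances[of F D Q])
    show "D x x = 0" if "x \<in> F" for x
      using P_fin[of x x] d_rules(1) that by (simp add: D_def pv_0)
    show "D x z \<le> D x y + D y z" if "x \<in> F" "y \<in> F" "z \<in> F" for x y z
      unfolding D_def using assms(4) P_nonneg P_tri Gal_tri that by (intro pv_scaled_triangle) auto
    show "0 \<le> D x y" if "x \<in> F" "y \<in> F" for x y
      unfolding D_def by (intro pv_nonneg \<gamma>P_nonneg that)
    show "0 \<le> Q x y" if "x \<in> F" "y \<in> F" for x y
      using Gal_mono[OF \<gamma>P_nonneg[OF that]] by (simp add: Q_def Gal_0)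
    \<comment> \<open>Both sides say that \<open>\<gamma> * P x y\<close> is limited. Different
      components of \<open>F\<close> merge when \<gamma> shrinks the distance between them to a
      limited one.\<close>
    show "Q x y = 0 \<longleftrightarrow> D x y < \<infinity>" if "x \<in> F" "y \<in> F" for x y
      unfolding Q_def D_def Gal_eq_0_iff pv_less_PInf_iff[OF \<gamma>P_nonneg[OF that]] ..
    show "D x y = D y x" "Q x y = Q y x" if "x \<in> F" "y \<in> F" for x y
      using P_sym[OF that] by (simp_all add: D_def Q_def)
  qed (use Q_tri in auto)
  have ind: "induced_map F' \<delta>' f (C x) = component_of F' \<delta>' (f x)" if "x \<in> F" for x
    unfolding C_def
  proof (rule induced_map_component_of[OF d _ _ _ that])
    show "\<delta>' (f x) (f y) < \<infinity>" if "x \<in> F" "y \<in> F" "\<delta> x y < \<infinity>" for x y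
    proof -
      have "limited (\<gamma> * P x y)"
        using that assms(3) lim_P limited_mult by blast
      then show ?thesis
        unfolding \<delta>'[OF that(1,2)] D_def pv_less_PInf_iff[OF \<gamma>P_nonneg[OF that(1,2)]] .
    qed
  qed (use space' f in auto)
  have smult: "g \<bullet>\<^sub>G \<Delta> (C x) (C y) = Gal (g * P x y)" if "x \<in> F" "y \<in> F" "limited g" for x y g
    using gal_smult_Gal[OF that(3)] Gal_P that by metis
  have "limited (\<gamma> + 1)"
    using assms(3) limited_add limited_of_real[of 1] by force
  have morphism: "galactic_morphism (F, \<delta>, \<Delta>) (F', \<delta>', \<Delta>') f"
    unfolding galactic_morphism.simps metric_components_eq C_def[symmetric]
  proof (intro conjI exI[of _ "\<gamma> + 1"] ballI; (elim imageE; hypsubst)?)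
    show "f ` F \<subseteq> F'" using f by simp
    show "0 < \<gamma> + 1" using assms(4) by (simp add: add_pos_pos)
    show "limited (\<gamma> + 1)" by fact
    fix x y assume xy: "x \<in> F" "y \<in> F"
    show "le_scaled (\<delta>' (f x) (f y)) (\<gamma> + 1) (\<delta> x y)"
      using assms(3,4) nonneg P_fin \<delta>' xy by (intro le_scaled_pv) (auto simp: D_def)
    \<comment> \<open>The galactic distances scale by \<gamma> exactly; nonnegativity of
      \<open>P\<close> lets the larger constant \<open>\<gamma> + 1\<close> serve both morphism
      conditions.\<close>
    have "Gal (\<gamma> * P x y) \<le> Gal ((\<gamma> + 1) * P x y)"
      using P_nonneg[OF xy] by (intro Gal_mono) (simp add: algebra_simps)
    then show "\<Delta>' (induced_map F' \<delta>' f (C x)) (induced_map F' \<delta>' f (C y)) \<le> (\<gamma> + 1) \<bullet>\<^sub>G \<Delta> (C x) (C y)"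
      using xy \<open>limited (\<gamma> + 1)\<close> by (simp add: ind \<Delta>' smult Q_def)
  qed
  have "galactic_contraction \<gamma> (F, \<delta>, \<Delta>) (F', \<delta>', \<Delta>') f"
    unfolding galactic_contraction.simps metric_components_eq C_def[symmetric]
  proof (intro conjI ballI impI; (elim imageE; hypsubst)?)
    show "galactic_morphism (F, \<delta>, \<Delta>) (F', \<delta>', \<Delta>') f" by (rule morphism)
    show "f ` F = F'" by (rule f)
    fix x y assume xy: "x \<in> F" "y \<in> F"
    show "\<Delta>' (induced_map F' \<delta>' f (C x)) (induced_map F' \<delta>' f (C y)) = \<gamma> \<bullet>\<^sub>G \<Delta> (C x) (C y)"
      using xy assms(3) by (simp add: ind \<Delta>' smult Q_def)
    show "\<delta>' (f x) (f y) = pv (\<gamma> * of_real (real_of_ereal (\<delta> x y)))" if "\<delta> x y < \<infinity>"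
      using xy that by (simp add: \<delta>' D_def P_fin)
    \<comment> \<open>At infinite distance \<open>P x y\<close> is an infinitely large
      representative of the galaxy, so \<open>pv_gal\<close> may be evaluated at it.\<close>
    show "\<delta>' (f x) (f y) = pv_gal \<gamma> (\<Delta> (C x) (C y))" if "\<delta> x y = \<infinity>"
      using xy that pv_gal_Gal[OF assms(4) P_nonneg[OF xy]] lim_P[OF xy] Gal_P[OF xy]
      by (simp add: \<delta>' D_def)
  qed
  with space' show ?thesis by blast
qed

end
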